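(* Let $M$ be a metric space, let $K(M)$ be the set of nonempty compact subsets of $M$ equipped with the Hausdorff distance, and let $X$ be a random variable with values in a compact set $\mathcal{K}\subset K(M)$. Let $k\in\mathbb{N}_0$, let $\beta_k:K(M)\to\hat{\mathcal{B}}_\infty$ be the $k$-th barcode map, and let $T:\hat{\mathcal{B}}_\infty\to V$ be a continuous map to a separable Banach space $V$ of type $2$. Then $\|T(\beta_k(X))\|$ has finite $n$-th moments for all $n\ge0$.
   Context: Homology has coefficients in a fixed field $\mathbf{k}$; reduced homology is $\tilde H_k(X)=\ker(H_k(X)\to H_k(\mathrm{pt}))$. Persistent homology: for a metric space $(M,d)$, a finite nonempty $P\subset M$ and $t\ge 0$, the Čech complex $\check C_t(P)$ is the abstract simplicial complex with vertex set $P$ in which $\{x_0,\dots,x_j\}$ spans a simplex iff $\bigcap_{i}\overline B_t(x_i)\neq\emptyset$, where $\overline B_t(x)=\{y\in M: d(x,y)\le t\}$. The persistence module $\mathrm{PH}_k(P)$ has $\mathrm{PH}_k(P)_t=\tilde H_k(\check C_t(P))$ for $t\ge 0$, with maps induced by inclusions. It is a direct sum of finitely many interval modules (an interval module is $\mathbf{k}$ on an interval and $0$ outside, with identity maps inside), all of finite length; the multiset of these intervals is the barcode of $\mathrm{PH}_k(P)$. Barcode space: $\mathcal{B}$ is the set of finite multisets of pairs $(x,d)\in\mathbb{R}_{\ge0}^2$ (an interval with left endpoint $x$ and length $d$), where two multisets are identified if they agree after deleting pairs with $d=0$. $\beta_k(P)\in\mathcal{B}$ is the multiset of pairs (left endpoint,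 length) of the intervals in the barcode of $\mathrm{PH}_k(P)$. Bottleneck distance: put $d_\infty((x_1,d_1),(x_2,d_2))=\max(|x_1-x_2|,|(x_1+d_1)-(x_2+d_2)|)$ and $d_\infty((x,d),\Delta)=d/2$. For $b_1=\{I_i\}_{i=1}^n$, $b_2=\{J_j\}_{j=1}^m$, $d_\infty(b_1,b_2)$ is the minimum over all bijections $\theta:A\to B$ with $A\subset\{1,\dots,n\}$, $B\subset\{1,\dots,m\}$ of $\max\big(\max_{a\in A}d_\infty(I_a,J_{\theta(a)}),\max_{a\notin A}d_\infty(I_a,\Delta),\max_{b\notin B}d_\infty(J_b,\Delta)\big)$. $\hat{\mathcal{B}}_\infty$ is the completion of $(\mathcal{B},d_\infty)$. Barcodes of compact sets: the Hausdorff distance on $K(M)$ is $d_H(A,B)=\max(\inf\{t\ge0: A\subset B_t\},\inf\{t\ge0:B\subset A_t\})$, where $A_t=\{x\in M: d(x,A)\le t\}$. The map $\beta_k$ on finite nonempty subsets is $1$-Lipschitz from $d_H$ to $d_\infty$, and $\beta_k:K(M)\to\hat{\mathcal{B}}_\infty$ denotes its unique continuous extension (also $1$-Lipschitz). Type $2$: a Banach space $V$ is of type $2$ if for every Rademacher sequence $(\varepsilon_i)$ (independent random variables with values $\pm1$, each with probability $1/2$) there is a constant $C$ such that $\big(\mathbb{E}\|\sum_i\varepsilon_ix_i\|^2\big)^{1/2}\le C\big(\sum_i\|x_i\|^2\big)^{1/2}$ for all finite sequences $(x_i)$ in $V$. *)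

theory Defs
  imports
    "HOL-Probability.Probability"
    "HOL-Library.Poly_Mapping"
    "HOL-Library.Set_Algebras"
begin

section \<open>Simplicial homology over a field\<close>

text \<open>
  An abstract simplicial complex is a set of finite nonempty sets. Its homology is computed from the
  ordered chain complex: the \<open>k\<close>-chains are the formal linear combinations of \<open>(k+1)\<close>-tuples of
  vertices (repetitions allowed) whose entries span a simplex. This needs no choice of an
  order or orientation, is functorial on the nose, and its homology is simplicial homology.
\<close>

definition chains :: "'a set set \<Rightarrow> nat \<Rightarrow> ('a list \<Rightarrow>\<^sub>0 'k::field) set" where
  "chains K k = {c. \<forall>xs\<in>Poly_Mapping.keys c. length xs = Suc k \<and> set xs \<in> K}"

definition boundary :: "('a list \<Rightarrow>\<^sub>0 'k::field) \<Rightarrow> ('a list \<Rightarrow>\<^sub>0 'k)" where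
  "boundary c = (\<Sum>xs\<in>Poly_Mapping.keys c. \<Sum>i<length xs.
     Poly_Mapping.single (take i xs @ drop (Suc i) xs) ((-1) ^ i * Poly_Mapping.lookup c xs))"

text \<open>The boundary of every \<open>0\<close>-chain is \<open>0\<close>; the formula above would give the augmentation.\<close>

definition cycles :: "'a set set \<Rightarrow> nat \<Rightarrow> ('a list \<Rightarrow>\<^sub>0 'k::field) set" where
  "cycles K k = {c \<in> chains K k. k = 0 \<or> boundary c = 0}"

definition boundaries :: "'a set set \<Rightarrow> nat \<Rightarrow> ('a list \<Rightarrow>\<^sub>0 'k::field) set" where
  "boundaries K k = boundary ` chains K (Suc k)"

text \<open>
  Homology classes are the cosets of the boundaries in the cycles; \<open>+o\<close> is translation of a set by
  an element and \<open>+\<close> on sets is elementwise addition. In particular the zero class is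
  \<open>boundaries K k\<close> itself.
\<close>

definition homology :: "'a set set \<Rightarrow> nat \<Rightarrow> ('a list \<Rightarrow>\<^sub>0 'k::field) set set" where
  "homology K k = {z +o boundaries K k | z. z \<in> cycles K k}"

definition scale_chain :: "'k::field \<Rightarrow> ('a list \<Rightarrow>\<^sub>0 'k) \<Rightarrow> ('a list \<Rightarrow>\<^sub>0 'k)" where
  "scale_chain a c = Poly_Mapping.map ((*) a) c"

text \<open>Adding the boundaries makes the result a coset also when \<open>a = 0\<close>.\<close>

definition scale_class ::
  "'a set set \<Rightarrow> nat \<Rightarrow> 'k::field \<Rightarrow> ('a list \<Rightarrow>\<^sub>0 'k) set \<Rightarrow> ('a list \<Rightarrow>\<^sub>0 'k) set" where
  "scale_class K k a A = scale_chain a ` A + boundaries K k"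

definition chain_map :: "('a \<Rightarrow> 'b) \<Rightarrow> ('a list \<Rightarrow>\<^sub>0 'k::field) \<Rightarrow> ('b list \<Rightarrow>\<^sub>0 'k)" where
  "chain_map f c =
     (\<Sum>xs\<in>Poly_Mapping.keys c. Poly_Mapping.single (map f xs) (Poly_Mapping.lookup c xs))"

text \<open>The map on homology induced by a simplicial map \<open>f\<close> into the complex \<open>L\<close>.\<close>

definition induced_map ::
  "'b set set \<Rightarrow> nat \<Rightarrow> ('a \<Rightarrow> 'b) \<Rightarrow> ('a list \<Rightarrow>\<^sub>0 'k::field) set \<Rightarrow> ('b list \<Rightarrow>\<^sub>0 'k) set" where
  "induced_map L k f A = chain_map f ` A + boundaries L k"

definition point_complex :: "unit set set" where
  "point_complex = {{()}}"

definition reduced_homology :: "'a set set \<Rightarrow> nat \<Rightarrow> ('a list \<Rightarrow>\<^sub>0 'k::field) set set" where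
  "reduced_homology K k =
     {A \<in> homology K k. induced_map point_complex k (\<lambda>_. ()) A = boundaries point_complex k}"


section \<open>Persistence modules\<close>

text \<open>
  A persistence module indexed by \<open>t \<ge> 0\<close>: at each index a vector space with the given carrier,
  addition and scalar multiplication, and for \<open>s \<le> t\<close> a transition map.
\<close>

record ('k, 'v) pmodule =
  pcarrier :: "real \<Rightarrow> 'v set"
  padd :: "real \<Rightarrow> 'v \<Rightarrow> 'v \<Rightarrow> 'v"
  pscale :: "real \<Rightarrow> 'k \<Rightarrow> 'v \<Rightarrow> 'v"
  pmap :: "real \<Rightarrow> real \<Rightarrow> 'v \<Rightarrow> 'v"

definition pmodule_iso :: "('k, 'v) pmodule \<Rightarrow> ('k, 'w) pmodule \<Rightarrow> bool" where
  "pmodule_iso M N \<longleftrightarrow> (\<exists>\<phi>.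
     (\<forall>t\<ge>0. bij_betw (\<phi> t) (pcarrier M t) (pcarrier N t)) \<and>
     (\<forall>t\<ge>0. \<forall>x\<in>pcarrier M t. \<forall>y\<in>pcarrier M t. \<phi> t (padd M t x y) = padd N t (\<phi> t x) (\<phi> t y)) \<and>
     (\<forall>t\<ge>0. \<forall>a. \<forall>x\<in>pcarrier M t. \<phi> t (pscale M t a x) = pscale N t a (\<phi> t x)) \<and>
     (\<forall>s\<ge>0. \<forall>t\<ge>s. \<forall>x\<in>pcarrier M s. \<phi> t (pmap M s t x) = pmap N s t (\<phi> s x)))"

definition interval_module :: "real set \<Rightarrow> ('k::field, 'k) pmodule" where
  "interval_module I =
     \<lparr>pcarrier = (\<lambda>t. if t \<in> I then UNIV else {0}),
      padd = (\<lambda>t. (+)),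
      pscale = (\<lambda>t. (*)),
      pmap = (\<lambda>s t x. if s \<in> I \<and> t \<in> I then x else 0)\<rparr>"

definition direct_sum :: "('k, 'v) pmodule list \<Rightarrow> ('k, nat \<Rightarrow> 'v) pmodule" where
  "direct_sum Ms =
     \<lparr>pcarrier = (\<lambda>t. \<Pi>\<^sub>E i\<in>{..<length Ms}. pcarrier (Ms ! i) t),
      padd = (\<lambda>t f g. \<lambda>i\<in>{..<length Ms}. padd (Ms ! i) t (f i) (g i)),
      pscale = (\<lambda>t a f. \<lambda>i\<in>{..<length Ms}. pscale (Ms ! i) t a (f i)),
      pmap = (\<lambda>s t f. \<lambda>i\<in>{..<length Ms}. pmap (Ms ! i) s t (f i))\<rparr>"

definition cech_complex :: "real \<Rightarrow> 'a::metric_space set \<Rightarrow> 'a set set" where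
  "cech_complex t P = {\<sigma>. \<sigma> \<noteq> {} \<and> finite \<sigma> \<and> \<sigma> \<subseteq> P \<and> (\<Inter>x\<in>\<sigma>. cball x t) \<noteq> {}}"

definition persistent_homology ::
  "nat \<Rightarrow> 'a::metric_space set \<Rightarrow> ('k::field, ('a list \<Rightarrow>\<^sub>0 'k) set) pmodule" where
  "persistent_homology k P =
     \<lparr>pcarrier = (\<lambda>t. reduced_homology (cech_complex t P) k),
      padd = (\<lambda>t. (+)),
      pscale = (\<lambda>t. scale_class (cech_complex t P) k),
      pmap = (\<lambda>s t. induced_map (cech_complex t P) k id)\<rparr>"


section \<open>The bottleneck distance\<close>

definition bars :: "(real \<times> real) multiset set" where
  "bars = {b. \<forall>(x, d)\<in>#b. 0 \<le> x \<and> 0 \<le> d}"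

definition bar_dist :: "real \<times> real \<Rightarrow> real \<times> real \<Rightarrow> real" where
  "bar_dist p q = max \<bar>fst p - fst q\<bar> \<bar>(fst p + snd p) - (fst q + snd q)\<bar>"

definition diag_dist :: "real \<times> real \<Rightarrow> real" where
  "diag_dist p = snd p / 2"

text \<open>
  The elements of a multiset listed with their multiplicity: an index \<open>(p, i)\<close> stands for the
  \<open>i\<close>-th copy of the bar \<open>p\<close>.
\<close>

definition indices :: "'p multiset \<Rightarrow> ('p \<times> nat) set" where
  "indices b = (SIGMA p:set_mset b. {..<count b p})"

definition matching_costs :: "(real \<times> real) multiset \<Rightarrow> (real \<times> real) multiset \<Rightarrow>
    ((real \<times> real) \<times> nat) set \<Rightarrow> ((real \<times> real) \<times> nat) set \<Rightarrow>
    ((real \<times> real) \<times> nat \<Rightarrow> (real \<times> real) \<times> nat) \<Rightarrow> real set" where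
  "matching_costs b c A B \<theta> =
     (\<lambda>a. bar_dist (fst a) (fst (\<theta> a))) ` A \<union>
     (\<lambda>a. diag_dist (fst a)) ` (indices b - A) \<union>
     (\<lambda>a. diag_dist (fst a)) ` (indices c - B)"

text \<open>The maximum over the empty set, for two empty barcodes, is read as \<open>0\<close>.\<close>

definition bottleneck :: "(real \<times> real) multiset \<Rightarrow> (real \<times> real) multiset \<Rightarrow> real" where
  "bottleneck b c =
     Min {Max (insert 0 (matching_costs b c A B \<theta>)) | A B \<theta>.
          A \<subseteq> indices b \<and> B \<subseteq> indices c \<and> bij_betw \<theta> A B}"

lemma finite_indices [simp]: "finite (indices b)"
  by (simp add: indices_def)

lemma indices_iff: "(p, i) \<in> indices b \<longleftrightarrow> i < count b p"
  by (auto simp: indices_def count_greater_zero_iff[symmetric] simp del: count_greater_zero_iff)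

definition matching_within where
  "matching_within b c A B \<theta> e \<longleftrightarrow> A \<subseteq> indices b \<and> B \<subseteq> indices c \<and> bij_betw \<theta> A B \<and> (0::real) \<le> e \<and>
     (\<forall>a\<in>A. bar_dist (fst a) (fst (\<theta> a)) \<le> e) \<and>
     (\<forall>a\<in>indices b - A. diag_dist (fst a) \<le> e) \<and> (\<forall>a\<in>indices c - B. diag_dist (fst a) \<le> e)"

lemma finite_matching_costs:
  assumes "A \<subseteq> indices b" shows "finite (matching_costs b c A B \<theta>)"
  using finite_subset[OF assms] by (simp add: matching_costs_def)

lemma Max_matching_costs_le_iff:
  assumes "A \<subseteq> indices b" "B \<subseteq> indices c" "bij_betw \<theta> A B"
  shows "Max (insert 0 (matching_costs b c A B \<theta>)) \<le> e \<longleftrightarrow> matching_within b c A B \<theta> e"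
proof -
  have "Max (insert 0 (matching_costs b c A B \<theta>)) \<le> e \<longleftrightarrow>
      0 \<le> e \<and> (\<forall>x\<in>matching_costs b c A B \<theta>. x \<le> e)"
    using finite_matching_costs[OF assms(1)] by (subst Max_le_iff) auto
  also have "\<dots> \<longleftrightarrow> matching_within b c A B \<theta> e"
    using assms unfolding matching_within_def matching_costs_def by (auto simp: ball_Un)
  finally show ?thesis .
qed

lemma finite_costs:
  "finite {Max (insert 0 (matching_costs b c A B \<theta>)) | A B \<theta>.
          A \<subseteq> indices b \<and> B \<subseteq> indices c \<and> bij_betw \<theta> A B}" (is "finite ?S")
proof (rule finite_subset)
  let ?F = "insert 0 ((\<lambda>(a, a'). bar_dist (fst a) (fst a')) ` (indices b \<times> indices c) \<union>
      (\<lambda>a. diag_dist (fst a)) ` (indices b \<union> indices c))"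
  show "finite ?F" by simp
  show "?S \<subseteq> ?F"
  proof
    fix m assume "m \<in> ?S"
    then obtain A B \<theta> where AB: "A \<subseteq> indices b" "B \<subseteq> indices c" "bij_betw \<theta> A B"
      and m: "m = Max (insert 0 (matching_costs b c A B \<theta>))" by blast
    have "m \<in> insert 0 (matching_costs b c A B \<theta>)"
      unfolding m using finite_matching_costs[OF AB(1)] by (intro Max_in) auto
    moreover have "matching_costs b c A B \<theta> \<subseteq> ?F"
    proof -
      have "\<theta> a \<in> indices c" if "a \<in> A" for a using AB that by (auto simp: bij_betw_def)
      then have "(\<lambda>a. bar_dist (fst a) (fst (\<theta> a))) ` A \<subseteq>
          (\<lambda>(a, a'). bar_dist (fst a) (fst a')) ` (indices b \<times> indices c)"
        using AB(1) by (force simp: image_iff)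
      then show ?thesis unfolding matching_costs_def by blast
    qed
    ultimately show "m \<in> ?F" by blast
  qed
qed

lemma bottleneck_attained: "\<exists>A B \<theta>. matching_within b c A B \<theta> (bottleneck b c)"
proof -
  let ?S = "{Max (insert 0 (matching_costs b c A B \<theta>)) | A B \<theta>.
          A \<subseteq> indices b \<and> B \<subseteq> indices c \<and> bij_betw \<theta> A B}"
  have "bij_betw id ({}::((real \<times> real) \<times> nat) set) {}" by simp
  then have "?S \<noteq> {}" by blast
  then have "bottleneck b c \<in> ?S"
    unfolding bottleneck_def using finite_costs by (intro Min_in)
  then obtain A B \<theta> where AB: "A \<subseteq> indices b" "B \<subseteq> indices c" "bij_betw \<theta> A B"
    and m: "bottleneck b c = Max (insert 0 (matching_costs b c A B \<theta>))" by blast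
  then show ?thesis using Max_matching_costs_le_iff[OF AB, of "bottleneck b c"] by auto
qed

lemma bottleneck_le:
  assumes "matching_within b c A B \<theta> e" shows "bottleneck b c \<le> e"
proof -
  have AB: "A \<subseteq> indices b" "B \<subseteq> indices c" "bij_betw \<theta> A B"
    using assms by (auto simp: matching_within_def)
  have "bottleneck b c \<le> Max (insert 0 (matching_costs b c A B \<theta>))"
    unfolding bottleneck_def using AB by (intro Min_le[OF finite_costs]) blast
  also have "\<dots> \<le> e" using Max_matching_costs_le_iff[OF AB] assms by blast
  finally show ?thesis .
qed

lemma bottleneck_nonneg: "0 \<le> bottleneck b c"
  using bottleneck_attained[of b c] by (auto simp: matching_within_def)

lemma bar_dist_commute: "bar_dist p q = bar_dist q p"
  by (simp add: bar_dist_def abs_minus_commute)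

lemma bottleneck_commute: "bottleneck b c = bottleneck c b"
proof -
  have "bottleneck c b \<le> bottleneck b c" for b c
  proof -
    obtain A B \<theta> where m: "matching_within b c A B \<theta> (bottleneck b c)"
      using bottleneck_attained by blast
    then have bij: "bij_betw \<theta> A B" by (simp add: matching_within_def)
    have "bar_dist (fst a) (fst (inv_into A \<theta> a)) \<le> bottleneck b c" if "a \<in> B" for a
    proof -
      have "inv_into A \<theta> a \<in> A" "\<theta> (inv_into A \<theta> a) = a"
        using bij that by (auto simp: bij_betw_def inv_into_into f_inv_into_f)
      with m show ?thesis unfolding matching_within_def by (metis bar_dist_commute)
    qed
    with m have "matching_within c b B A (inv_into A \<theta>) (bottleneck b c)"
      using bij_betw_inv_into[OF bij] by (simp add: matching_within_def)
    then show ?thesis by (rule bottleneck_le)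
  qed
  then show ?thesis by (simp add: order_antisym)
qed

lemma bottleneck_triangle: "bottleneck b d \<le> bottleneck b c + bottleneck c d"
proof -
  obtain A B \<theta> where m1: "matching_within b c A B \<theta> (bottleneck b c)"
    using bottleneck_attained by blast
  obtain A' B' \<theta>' where m2: "matching_within c d A' B' \<theta>' (bottleneck c d)"
    using bottleneck_attained by blast
  let ?e = "bottleneck b c" and ?e' = "bottleneck c d"
  have inj: "inj_on \<theta> A" "\<theta> ` A = B" "inj_on \<theta>' A'" "\<theta>' ` A' = B'"
    using m1 m2 by (auto simp: matching_within_def bij_betw_def)
  have nn: "0 \<le> ?e" "0 \<le> ?e'" by (simp_all add: bottleneck_nonneg)
  define A2 where "A2 = {a\<in>A. \<theta> a \<in> A'}"
  define B2 where "B2 = (\<theta>' \<circ> \<theta>) ` A2"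
  have diag: "diag_dist p \<le> bar_dist p q + diag_dist q" for p q
    unfolding diag_dist_def bar_dist_def by argo
  have tri: "bar_dist p r \<le> bar_dist p q + bar_dist q r" for p q r
    unfolding bar_dist_def by argo
  have "matching_within b d A2 B2 (\<theta>' \<circ> \<theta>) (?e + ?e')"
    unfolding matching_within_def
  proof (intro conjI ballI)
    show "A2 \<subseteq> indices b" using m1 by (auto simp: A2_def matching_within_def)
    show "B2 \<subseteq> indices d" using m2 inj by (auto simp: A2_def B2_def matching_within_def)
    have "inj_on (\<theta>' \<circ> \<theta>) A2"
      using inj by (auto simp: A2_def inj_on_def)
    then show "bij_betw (\<theta>' \<circ> \<theta>) A2 B2" by (simp add: B2_def bij_betw_def)
    show "0 \<le> ?e + ?e'" using nn by simp
  next
    fix a assume a: "a \<in> A2"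
    then have "bar_dist (fst a) (fst (\<theta> a)) \<le> ?e" "bar_dist (fst (\<theta> a)) (fst (\<theta>' (\<theta> a))) \<le> ?e'"
      using m1 m2 by (auto simp: A2_def matching_within_def)
    then show "bar_dist (fst a) (fst ((\<theta>' \<circ> \<theta>) a)) \<le> ?e + ?e'"
      using tri[of "fst a" "fst (\<theta>' (\<theta> a))" "fst (\<theta> a)"] by simp
  next
    fix a assume a: "a \<in> indices b - A2"
    show "diag_dist (fst a) \<le> ?e + ?e'"
    proof (cases "a \<in> A")
      case True
      then have "\<theta> a \<in> indices c - A'" "bar_dist (fst a) (fst (\<theta> a)) \<le> ?e"
        using a m1 inj by (auto simp: A2_def matching_within_def)
      moreover from this have "diag_dist (fst (\<theta> a)) \<le> ?e'"
        using m2 by (auto simp: matching_within_def)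
      ultimately show ?thesis using diag[of "fst a" "fst (\<theta> a)"] by linarith
    next
      case False
      then have "diag_dist (fst a) \<le> ?e" using a m1 by (auto simp: matching_within_def)
      then show ?thesis using nn by simp
    qed
  next
    fix a assume a: "a \<in> indices d - B2"
    show "diag_dist (fst a) \<le> ?e + ?e'"
    proof (cases "a \<in> B'")
      case True
      then obtain a' where a': "a' \<in> A'" "a = \<theta>' a'" using inj by blast
      have "a' \<notin> B"
      proof
        assume "a' \<in> B"
        then obtain a0 where "a0 \<in> A" "a' = \<theta> a0" using inj by blast
        then have "a \<in> B2" using a' by (auto simp: A2_def B2_def)
        then show False using a by simp
      qed
      then have "a' \<in> indices c - B" using a' m2 by (auto simp: matching_within_def)
      then have "diag_dist (fst a') \<le> ?e" using m1 by (auto simp: matching_within_def)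
      moreover have "bar_dist (fst a') (fst a) \<le> ?e'"
        using a' m2 by (auto simp: matching_within_def)
      ultimately show ?thesis
        using diag[of "fst a" "fst a'"] bar_dist_commute[of "fst a" "fst a'"] by linarith
    next
      case False
      then have "diag_dist (fst a) \<le> ?e'" using a m2 by (auto simp: matching_within_def)
      then show ?thesis using nn by simp
    qed
  qed
  then show ?thesis by (rule bottleneck_le)
qed


section \<open>The space of barcodes\<close>

definition barcode_eq :: "(real \<times> real) multiset \<Rightarrow> (real \<times> real) multiset \<Rightarrow> bool" where
  "barcode_eq b c \<longleftrightarrow> b \<in> bars \<and> c \<in> bars \<and>
     filter_mset (\<lambda>(x, d). d \<noteq> 0) b = filter_mset (\<lambda>(x, d). d \<noteq> 0) c"

lemma bottleneck_eq_0_iff: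
  assumes "b \<in> bars" "c \<in> bars"
  shows "bottleneck b c = 0 \<longleftrightarrow> barcode_eq b c"
proof
  assume eq: "barcode_eq b c"
  then have cnt: "count b p = count c p" if "snd p \<noteq> 0" for p
  proof -
    have "count (filter_mset (\<lambda>(x, d). d \<noteq> 0) b) p = count (filter_mset (\<lambda>(x, d). d \<noteq> 0) c) p"
      using eq by (simp add: barcode_eq_def)
    then show ?thesis using that by (simp add: case_prod_beta)
  qed
  let ?A = "{(p, i). i < count b p \<and> snd p \<noteq> 0}"
  have "matching_within b c ?A ?A id 0"
    unfolding matching_within_def
    using cnt by (auto simp: indices_iff bar_dist_def diag_dist_def)
  then show "bottleneck b c = 0" using bottleneck_le bottleneck_nonneg by (meson order_antisym)
next
  assume 0: "bottleneck b c = 0"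
  have le: "count b p \<le> count c p"
    if bc: "bottleneck b c = 0" and p: "snd p > 0" for p b c
  proof -
    obtain A B \<theta> where m: "matching_within b c A B \<theta> 0"
      using bottleneck_attained[of b c] bc by auto
    have inA: "(p, i) \<in> A" if i: "i < count b p" for i
    proof (rule ccontr)
      assume "(p, i) \<notin> A"
      then have "(p, i) \<in> indices b - A" using i by (simp add: indices_iff)
      then have "diag_dist (fst (p, i)) \<le> 0" using m unfolding matching_within_def by blast
      then show False using p by (simp add: diag_dist_def)
    qed
    have \<theta>: "fst (\<theta> (p, i)) = p" "\<theta> (p, i) \<in> indices c" if i: "i < count b p" for i
    proof -
      have "bar_dist p (fst (\<theta> (p, i))) \<le> 0"
        using m inA[OF i] unfolding matching_within_def by (metis fst_conv)
      then show "fst (\<theta> (p, i)) = p" by (auto simp: bar_dist_def prod_eq_iff)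
      show "\<theta> (p, i) \<in> indices c"
        using m inA[OF i] unfolding matching_within_def bij_betw_def by blast
    qed
    have "card ({p} \<times> {..<count b p}) \<le> card ({p} \<times> {..<count c p})"
    proof (rule card_inj_on_le)
      show "inj_on \<theta> ({p} \<times> {..<count b p})"
      proof (rule inj_on_subset)
        show "inj_on \<theta> A" using m by (simp add: matching_within_def bij_betw_def)
        show "{p} \<times> {..<count b p} \<subseteq> A" using inA by auto
      qed
      show "\<theta> ` ({p} \<times> {..<count b p}) \<subseteq> {p} \<times> {..<count c p}"
      proof
        fix y assume "y \<in> \<theta> ` ({p} \<times> {..<count b p})"
        then obtain i where i: "i < count b p" "y = \<theta> (p, i)" by auto
        obtain q j where y: "y = (q, j)" by (cases y)
        have "q = p" "(q, j) \<in> indices c" using \<theta>[OF i(1)] i(2) y by (metis fst_conv)+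
        then show "y \<in> {p} \<times> {..<count c p}" using y by (simp add: indices_iff)
      qed
    qed auto
    then show ?thesis by (simp add: card_cartesian_product)
  qed
  have pos: "count b p = count c p" if "snd p > 0" for p
    using le[OF 0 that] le[of c b p] 0 that by (simp add: bottleneck_commute)
  have neg: "count b p = 0" "count c p = 0" if "snd p < 0" for p
  proof -
    have "p \<notin># b" "p \<notin># c" using assms that unfolding bars_def by fastforce+
    then show "count b p = 0" "count c p = 0" by (simp_all add: not_in_iff)
  qed
  have "count b p = count c p" if "snd p \<noteq> 0" for p
    using pos[of p] neg[of p] that by (metis linorder_neqE_linordered_idom)
  then have "filter_mset (\<lambda>(x, d). d \<noteq> 0) b = filter_mset (\<lambda>(x, d). d \<noteq> 0) c"
    by (intro multiset_eqI) (simp add: case_prod_beta)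
  then show "barcode_eq b c"
    using assms by (simp add: barcode_eq_def)
qed

quotient_type barcode = "(real \<times> real) multiset" / partial: barcode_eq
proof (rule part_equivpI)
  show "\<exists>b. barcode_eq b b"
    by (intro exI[of _ "{#}"]) (simp add: barcode_eq_def bars_def)
  show "symp barcode_eq" by (auto simp: symp_def barcode_eq_def)
  show "transp barcode_eq" by (auto simp: transp_def barcode_eq_def)
qed

instantiation barcode :: metric_space
begin

lift_definition dist_barcode :: "barcode \<Rightarrow> barcode \<Rightarrow> real" is bottleneck
proof -
  fix b b' c c' assume "barcode_eq b b'" "barcode_eq c c'"
  then have "bottleneck b b' = 0" "bottleneck c c' = 0"
    by (metis barcode_eq_def bottleneck_eq_0_iff)+
  then show "bottleneck b c = bottleneck b' c'"
    using bottleneck_triangle[of b c b'] bottleneck_triangle[of b' c c']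
      bottleneck_triangle[of b' c' b] bottleneck_triangle[of b c' c]
      bottleneck_commute[of b b'] bottleneck_commute[of c c'] by linarith
qed

definition uniformity_barcode :: "(barcode \<times> barcode) filter" where
  "uniformity_barcode = (INF e\<in>{0<..}. principal {(x, y). dist x y < e})"

definition open_barcode :: "barcode set \<Rightarrow> bool" where
  "open_barcode U = (\<forall>x\<in>U. eventually (\<lambda>(x', y). x' = x \<longrightarrow> y \<in> U) uniformity)"

instance
proof
  fix x y z :: barcode
  show "dist x y = 0 \<longleftrightarrow> x = y"
    by transfer (metis barcode_eq_def bottleneck_eq_0_iff)
  show "dist x y \<le> dist x z + dist y z"
    by transfer (metis bottleneck_commute bottleneck_triangle)
qed (simp_all add: uniformity_barcode_def open_barcode_def)

end


section \<open>Completion of a metric space\<close>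

definition cauchy_eq :: "(nat \<Rightarrow> 'a::metric_space) \<Rightarrow> (nat \<Rightarrow> 'a) \<Rightarrow> bool" where
  "cauchy_eq X Y \<longleftrightarrow> Cauchy X \<and> Cauchy Y \<and> (\<lambda>n. dist (X n) (Y n)) \<longlonglongrightarrow> 0"

quotient_type (overloaded) 'a cauchy_completion = "nat \<Rightarrow> 'a::metric_space" / partial: cauchy_eq
proof (rule part_equivpI)
  show "\<exists>X::nat \<Rightarrow> 'a. cauchy_eq X X"
    by (intro exI[of _ "\<lambda>_. undefined"]) (simp add: cauchy_eq_def Cauchy_def)
  show "symp (cauchy_eq :: (nat \<Rightarrow> 'a) \<Rightarrow> _)" by (auto simp: symp_def cauchy_eq_def dist_commute)
  show "transp (cauchy_eq :: (nat \<Rightarrow> 'a) \<Rightarrow> _)"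
  proof (rule transpI)
    fix X Y Z :: "nat \<Rightarrow> 'a" assume *: "cauchy_eq X Y" "cauchy_eq Y Z"
    then have "(\<lambda>n. dist (X n) (Y n) + dist (Y n) (Z n)) \<longlonglongrightarrow> 0"
      unfolding cauchy_eq_def using tendsto_add_zero by blast
    then have "(\<lambda>n. dist (X n) (Z n)) \<longlonglongrightarrow> 0"
      by (rule tendsto_0_le[where K = 1])
         (auto intro!: always_eventually dist_triangle)
    then show "cauchy_eq X Z" using * by (simp add: cauchy_eq_def)
  qed
qed

lemma convergent_dist:
  fixes X Y :: "nat \<Rightarrow> 'a::metric_space"
  assumes "Cauchy X" "Cauchy Y"
  shows "(\<lambda>n. dist (X n) (Y n)) \<longlonglongrightarrow> lim (\<lambda>n. dist (X n) (Y n))"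
proof -
  have "Cauchy (\<lambda>n. dist (X n) (Y n))"
  proof (rule metric_CauchyI)
    fix e :: real assume "e > 0"
    then obtain M N where MN: "\<And>m n. m \<ge> M \<Longrightarrow> n \<ge> M \<Longrightarrow> dist (X m) (X n) < e / 2"
      "\<And>m n. m \<ge> N \<Longrightarrow> n \<ge> N \<Longrightarrow> dist (Y m) (Y n) < e / 2"
      using assms by (metis half_gt_zero metric_CauchyD)
    have "dist (dist (X m) (Y m)) (dist (X n) (Y n)) < e" if "m \<ge> max M N" "n \<ge> max M N" for m n
    proof -
      have "dist (X m) (X n) < e / 2" "dist (Y m) (Y n) < e / 2" using MN that by auto
      then show ?thesis
        using dist_triangle[of "X m" "Y m" "X n"] dist_triangle[of "X n" "Y m" "Y n"]
          dist_triangle[of "X n" "Y n" "X m"] dist_triangle[of "X m" "Y n" "Y m"]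
        unfolding dist_real_def by (simp add: dist_commute abs_less_iff)
    qed
    then show "\<exists>M. \<forall>m\<ge>M. \<forall>n\<ge>M. dist (dist (X m) (Y m)) (dist (X n) (Y n)) < e" by blast
  qed
  then show ?thesis by (simp add: convergent_LIMSEQ_iff[symmetric] real_Cauchy_convergent)
qed

instantiation cauchy_completion :: (metric_space) metric_space
begin

lift_definition dist_cauchy_completion ::
  "'a cauchy_completion \<Rightarrow> 'a cauchy_completion \<Rightarrow> real"
  is "\<lambda>X Y. lim (\<lambda>n. dist (X n) (Y n))"
proof -
  fix X X' Y Y' :: "nat \<Rightarrow> 'a"
  assume *: "cauchy_eq X X'" "cauchy_eq Y Y'"
  have "(\<lambda>n. dist (X n) (Y n) - dist (X' n) (Y' n)) \<longlonglongrightarrow> 0"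
  proof (rule Lim_null_comparison)
    show "\<forall>\<^sub>F n in sequentially.
        norm (dist (X n) (Y n) - dist (X' n) (Y' n)) \<le> dist (X n) (X' n) + dist (Y n) (Y' n)"
    proof (intro always_eventually allI)
      fix n
      show "norm (dist (X n) (Y n) - dist (X' n) (Y' n)) \<le> dist (X n) (X' n) + dist (Y n) (Y' n)"
        using dist_triangle[of "X n" "Y n" "X' n"] dist_triangle[of "X' n" "Y n" "Y' n"]
          dist_triangle[of "X' n" "Y' n" "X n"] dist_triangle[of "X n" "Y' n" "Y n"]
        unfolding real_norm_def by (simp add: dist_commute abs_le_iff)
    qed
    show "(\<lambda>n. dist (X n) (X' n) + dist (Y n) (Y' n)) \<longlonglongrightarrow> 0"
      using * tendsto_add[of "\<lambda>n. dist (X n) (X' n)" 0 sequentially "\<lambda>n. dist (Y n) (Y' n)" 0]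
      by (simp add: cauchy_eq_def)
  qed
  moreover have "(\<lambda>n. dist (X n) (Y n) - dist (X' n) (Y' n)) \<longlonglongrightarrow>
      lim (\<lambda>n. dist (X n) (Y n)) - lim (\<lambda>n. dist (X' n) (Y' n))"
    using * unfolding cauchy_eq_def by (intro tendsto_diff convergent_dist) auto
  ultimately show "lim (\<lambda>n. dist (X n) (Y n)) = lim (\<lambda>n. dist (X' n) (Y' n))"
    using LIMSEQ_unique by fastforce
qed

definition uniformity_cauchy_completion ::
  "('a cauchy_completion \<times> 'a cauchy_completion) filter" where
  "uniformity_cauchy_completion = (INF e\<in>{0<..}. principal {(x, y). dist x y < e})"

definition open_cauchy_completion :: "'a cauchy_completion set \<Rightarrow> bool" where
  "open_cauchy_completion U = (\<forall>x\<in>U. eventually (\<lambda>(x', y). x' = x \<longrightarrow> y \<in> U) uniformity)"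

instance
proof
  fix x y z :: "'a cauchy_completion"
  show "dist x y = 0 \<longleftrightarrow> x = y"
  proof transfer
    fix X Y :: "nat \<Rightarrow> 'a" assume "cauchy_eq X X" "cauchy_eq Y Y"
    then have "Cauchy X" "Cauchy Y" by (auto simp: cauchy_eq_def)
    then show "lim (\<lambda>n. dist (X n) (Y n)) = 0 \<longleftrightarrow> cauchy_eq X Y"
      using convergent_dist[of X Y] limI[of "\<lambda>n. dist (X n) (Y n)" 0]
      unfolding cauchy_eq_def by metis
  qed
  show "dist x y \<le> dist x z + dist y z"
  proof transfer
    fix X Y Z :: "nat \<Rightarrow> 'a" assume "cauchy_eq X X" "cauchy_eq Y Y" "cauchy_eq Z Z"
    then have C: "Cauchy X" "Cauchy Y" "Cauchy Z" by (auto simp: cauchy_eq_def)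
    show "lim (\<lambda>n. dist (X n) (Y n)) \<le> lim (\<lambda>n. dist (X n) (Z n)) + lim (\<lambda>n. dist (Y n) (Z n))"
      by (rule LIMSEQ_le[OF convergent_dist[OF C(1,2)]
            tendsto_add[OF convergent_dist[OF C(1,3)] convergent_dist[OF C(2,3)]]])
         (auto intro: dist_triangle2)
  qed
qed (simp_all add: uniformity_cauchy_completion_def open_cauchy_completion_def)

end

lift_definition to_completion :: "'a::metric_space \<Rightarrow> 'a cauchy_completion" is "\<lambda>x n. x"
  by (simp add: cauchy_eq_def Cauchy_def)

lemma dist_to_completion: "dist (to_completion x) (to_completion y) = dist x y"
  by transfer (simp add: limI)

lemma to_completion_dense:
  fixes z :: "'a::metric_space cauchy_completion"
  assumes "e > 0" shows "\<exists>x. dist z (to_completion x) < e"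
  using assms
proof (transfer fixing: e)
  fix Z :: "nat \<Rightarrow> 'a" assume "cauchy_eq Z Z" "e > 0"
  then have C: "Cauchy Z" by (simp add: cauchy_eq_def)
  then obtain N where N: "\<And>m n. m \<ge> N \<Longrightarrow> n \<ge> N \<Longrightarrow> dist (Z m) (Z n) < e / 2"
    using \<open>e > 0\<close> by (metis half_gt_zero metric_CauchyD)
  have "Cauchy (\<lambda>n. Z N)" by (simp add: Cauchy_def)
  from convergent_dist[OF C this] have "lim (\<lambda>n. dist (Z n) (Z N)) \<le> e / 2"
    by (rule LIMSEQ_le_const2) (use N in \<open>auto intro!: exI[of _ N] less_imp_le\<close>)
  then have "lim (\<lambda>n. dist (Z n) (Z N)) < e" using \<open>e > 0\<close> by linarith
  then show "\<exists>x. lim (\<lambda>n. dist (Z n) x) < e" by blast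
qed

instance cauchy_completion :: (metric_space) complete_space
proof
  fix Z :: "nat \<Rightarrow> 'a cauchy_completion" assume Z: "Cauchy Z"
  have "\<forall>n. \<exists>x. dist (Z n) (to_completion x) < inverse (real (Suc n))"
    by (intro allI to_completion_dense) simp
  then obtain a where a: "\<And>n. dist (Z n) (to_completion (a n)) < inverse (real (Suc n))"
    by metis
  have close: "(\<lambda>n. dist (Z n) (to_completion (a n))) \<longlonglongrightarrow> 0"
    by (rule tendsto_0_le[OF LIMSEQ_inverse_real_of_nat, where K = 1])
       (use a in \<open>auto intro!: always_eventually less_imp_le\<close>)
  have "Cauchy (\<lambda>n. to_completion (a n))"
  proof (rule metric_CauchyI)
    fix e :: real assume e: "e > 0"
    obtain M where M: "\<And>m n. m \<ge> M \<Longrightarrow> n \<ge> M \<Longrightarrow> dist (Z m) (Z n) < e / 3"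
      using metric_CauchyD[OF Z, of "e / 3"] e by auto
    obtain N where N: "\<And>n. n \<ge> N \<Longrightarrow> dist (Z n) (to_completion (a n)) < e / 3"
      using metric_LIMSEQ_D[OF close, of "e / 3"] e by auto
    have "dist (to_completion (a m)) (to_completion (a n)) < e" if mn: "m \<ge> max M N" "n \<ge> max M N" for m n
    proof -
      have "dist (Z m) (Z n) < e / 3" "dist (Z m) (to_completion (a m)) < e / 3"
        "dist (Z n) (to_completion (a n)) < e / 3" using M N mn by auto
      then show ?thesis
        using dist_triangle[of "to_completion (a m)" "to_completion (a n)" "Z m"]
          dist_triangle[of "Z m" "to_completion (a n)" "Z n"] by (simp add: dist_commute)
    qed
    then show "\<exists>M. \<forall>m\<ge>M. \<forall>n\<ge>M. dist (to_completion (a m)) (to_completion (a n)) < e" by blast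
  qed
  then have Ca: "Cauchy a" by (simp add: Cauchy_def dist_to_completion)
  define z where "z = abs_cauchy_completion a"
  have dz: "dist (to_completion (a n)) z = lim (\<lambda>m. dist (a n) (a m))" for n
    unfolding z_def to_completion_def using Ca
    by (simp add: dist_cauchy_completion.abs_eq cauchy_eq_def Cauchy_def)
  have "(\<lambda>n. to_completion (a n)) \<longlonglongrightarrow> z"
  proof (rule metric_LIMSEQ_I)
    fix e :: real assume e: "e > 0"
    obtain N where N: "\<And>m n. m \<ge> N \<Longrightarrow> n \<ge> N \<Longrightarrow> dist (a m) (a n) < e / 2"
      using metric_CauchyD[OF Ca, of "e / 2"] e by auto
    have "dist (to_completion (a n)) z < e" if n: "n \<ge> N" for n
    proof -
      have "Cauchy (\<lambda>m. a n)" by (simp add: Cauchy_def)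
      from convergent_dist[OF this Ca] have "lim (\<lambda>m. dist (a n) (a m)) \<le> e / 2"
        by (rule LIMSEQ_le_const2) (use N n in \<open>auto intro!: exI[of _ N] less_imp_le\<close>)
      then show ?thesis using e dz by simp
    qed
    then show "\<exists>N. \<forall>n\<ge>N. dist (to_completion (a n)) z < e" by blast
  qed
  then have "(\<lambda>n. dist (to_completion (a n)) z) \<longlonglongrightarrow> 0" by (rule tendsto_dist_iff[THEN iffD1])
  from tendsto_add_zero[OF close this] have "(\<lambda>n. dist (Z n) z) \<longlonglongrightarrow> 0"
    by (rule tendsto_0_le[where K = 1]) (auto intro!: always_eventually dist_triangle)
  then have "Z \<longlonglongrightarrow> z" by (rule tendsto_dist_iff[THEN iffD2])
  then show "convergent Z" by (auto simp: convergent_def)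
qed


section \<open>Compact sets with the Hausdorff distance\<close>

definition thickening :: "real \<Rightarrow> 'a::metric_space set \<Rightarrow> 'a set" where
  "thickening t A = {x. infdist x A \<le> t}"

definition hausdorff_dist :: "'a::metric_space set \<Rightarrow> 'a set \<Rightarrow> real" where
  "hausdorff_dist A B =
     max (Inf {t. 0 \<le> t \<and> A \<subseteq> thickening t B}) (Inf {t. 0 \<le> t \<and> B \<subseteq> thickening t A})"

lemma Inf_thickening_le_iff:
  assumes "bounded A" "B \<noteq> {}"
  shows "Inf {t. 0 \<le> t \<and> A \<subseteq> thickening t B} \<le> e \<longleftrightarrow> 0 \<le> e \<and> (\<forall>x\<in>A. infdist x B \<le> e)"
proof -
  let ?S = "{t. 0 \<le> t \<and> A \<subseteq> thickening t B}"
  obtain b where b: "b \<in> B" using assms by blast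
  obtain r where r: "\<And>x. x \<in> A \<Longrightarrow> dist b x \<le> r"
    using assms(1) unfolding bounded_any_center[where a = b] by blast
  have "infdist x B \<le> \<bar>r\<bar>" if "x \<in> A" for x
    using infdist_le[OF b, of x] r[OF that] by (simp add: dist_commute)
  then have ne: "\<bar>r\<bar> \<in> ?S" by (auto simp: thickening_def)
  have bdd: "bdd_below ?S" by (intro bdd_belowI[of _ 0]) simp
  have ne': "?S \<noteq> {}" using ne by blast
  have "0 \<le> Inf ?S" using ne' by (rule cInf_greatest) simp
  moreover have "infdist x B \<le> Inf ?S" if "x \<in> A" for x
    using ne' by (rule cInf_greatest) (use that in \<open>auto simp: thickening_def\<close>)
  moreover have "Inf ?S \<le> e" if "0 \<le> e" "\<forall>x\<in>A. infdist x B \<le> e"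
    using that by (intro cInf_lower[OF _ bdd]) (auto simp: thickening_def)
  ultimately show ?thesis by (intro iffI conjI ballI) (auto intro: order_trans)
qed

lemma hausdorff_dist_le_iff:
  assumes "bounded A" "A \<noteq> {}" "bounded B" "B \<noteq> {}"
  shows "hausdorff_dist A B \<le> e \<longleftrightarrow>
    0 \<le> e \<and> (\<forall>x\<in>A. infdist x B \<le> e) \<and> (\<forall>x\<in>B. infdist x A \<le> e)"
  unfolding hausdorff_dist_def using assms by (auto simp: Inf_thickening_le_iff)

typedef (overloaded) 'a compacts = "{K::'a::metric_space set. compact K \<and> K \<noteq> {}}"
  by (rule exI[of _ "{undefined}"]) simp

setup_lifting type_definition_compacts

instantiation compacts :: (metric_space) metric_space
begin

lift_definition dist_compacts :: "'a compacts \<Rightarrow> 'a compacts \<Rightarrow> real" is hausdorff_dist .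

definition uniformity_compacts :: "('a compacts \<times> 'a compacts) filter" where
  "uniformity_compacts = (INF e\<in>{0<..}. principal {(x, y). dist x y < e})"

definition open_compacts :: "'a compacts set \<Rightarrow> bool" where
  "open_compacts U = (\<forall>x\<in>U. eventually (\<lambda>(x', y). x' = x \<longrightarrow> y \<in> U) uniformity)"

instance
proof
  fix x y z :: "'a compacts"
  show "dist x y = 0 \<longleftrightarrow> x = y"
  proof -
    let ?A = "Rep_compacts x" and ?B = "Rep_compacts y"
    have AB: "bounded ?A" "?A \<noteq> {}" "bounded ?B" "?B \<noteq> {}" and cl: "closed ?A" "closed ?B"
      using Rep_compacts[of x] Rep_compacts[of y]
      by (simp_all add: compact_imp_bounded compact_imp_closed)
    have "hausdorff_dist ?A ?B = 0 \<longleftrightarrow> hausdorff_dist ?A ?B \<le> 0"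
      using hausdorff_dist_le_iff[OF AB, of "hausdorff_dist ?A ?B"] by (simp add: order_antisym_conv)
    also have "\<dots> \<longleftrightarrow> (\<forall>z\<in>?A. infdist z ?B = 0) \<and> (\<forall>z\<in>?B. infdist z ?A = 0)"
      unfolding hausdorff_dist_le_iff[OF AB] by (simp add: infdist_nonneg order_antisym_conv)
    also have "\<dots> \<longleftrightarrow> ?A = ?B"
      using cl AB by (auto simp: in_closed_iff_infdist_zero[symmetric])
    finally show ?thesis by (simp add: dist_compacts.rep_eq Rep_compacts_inject)
  qed
  show "dist x y \<le> dist x z + dist y z"
  proof -
    define A B C where ABC_def: "A = Rep_compacts x" "B = Rep_compacts y" "C = Rep_compacts z"
    have ABC: "bounded A" "A \<noteq> {}" "bounded B" "B \<noteq> {}" "bounded C" "C \<noteq> {}"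
      using Rep_compacts[of x] Rep_compacts[of y] Rep_compacts[of z]
      by (simp_all add: ABC_def compact_imp_bounded)
    note AC = hausdorff_dist_le_iff[OF ABC(1,2,5,6), of "hausdorff_dist A C", simplified]
    note BC = hausdorff_dist_le_iff[OF ABC(3,4,5,6), of "hausdorff_dist B C", simplified]
    have step: "infdist x B \<le> d + e"
      if x: "infdist x C \<le> d" and C: "\<forall>y\<in>C. infdist y B \<le> e" for x B d e
    proof -
      have "infdist x B - e \<le> dist x y" if "y \<in> C" for y
        using infdist_triangle[of x B y] C that by fastforce
      then have "infdist x B - e \<le> infdist x C"
        unfolding infdist_notempty[OF ABC(6)] by (intro cINF_greatest[OF ABC(6)])
      then show ?thesis using x by linarith
    qed
    have "hausdorff_dist A B \<le> hausdorff_dist A C + hausdorff_dist B C"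
      unfolding hausdorff_dist_le_iff[OF ABC(1-4)]
    proof (intro conjI ballI)
      show "0 \<le> hausdorff_dist A C + hausdorff_dist B C" using AC BC by simp
      show "infdist x B \<le> hausdorff_dist A C + hausdorff_dist B C" if "x \<in> A" for x
        using step[of x "hausdorff_dist A C" B "hausdorff_dist B C"] AC BC that by blast
      show "infdist x A \<le> hausdorff_dist A C + hausdorff_dist B C" if "x \<in> B" for x
        using step[of x "hausdorff_dist B C" A "hausdorff_dist A C"] AC BC that
        by (simp add: add.commute)
    qed
    then show ?thesis by (simp add: dist_compacts.rep_eq ABC_def)
  qed
qed (simp_all add: uniformity_compacts_def open_compacts_def)

end


section \<open>The barcode map\<close>

definition is_barcode :: "'k::field itself \<Rightarrow> nat \<Rightarrow> 'a::metric_space set \<Rightarrow> barcode \<Rightarrow> bool" where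
  "is_barcode F k P b \<longleftrightarrow> (\<exists>Is.
     (\<forall>I\<in>set Is. is_interval I \<and> I \<noteq> {} \<and> bounded I \<and> I \<subseteq> {0..}) \<and>
     pmodule_iso (persistent_homology k P :: ('k, _) pmodule)
       (direct_sum (map interval_module Is)) \<and>
     b = abs_barcode (image_mset (\<lambda>I. (Inf I, Sup I - Inf I)) (mset Is)))"

definition finite_barcode :: "'k::field itself \<Rightarrow> nat \<Rightarrow> 'a::metric_space set \<Rightarrow> barcode" where
  "finite_barcode F k P = (THE b. is_barcode F k P b)"

text \<open>
  \<open>\<beta>\<close> is the continuous extension of the barcode map from finite to compact sets. By density of the
  finite sets there is at most one such \<open>\<beta>\<close>; it exists by the stability theorem.
\<close>

definition is_barcode_map ::
  "'k::field itself \<Rightarrow> nat \<Rightarrow> ('a::metric_space compacts \<Rightarrow> barcode cauchy_completion) \<Rightarrow> bool" where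
  "is_barcode_map F k \<beta> \<longleftrightarrow> continuous_on UNIV \<beta> \<and>
     (\<forall>P. finite P \<and> P \<noteq> {} \<longrightarrow> \<beta> (Abs_compacts P) = to_completion (finite_barcode F k P))"

lemma finite_compacts_dense:
  "closure {Abs_compacts P | P. finite P \<and> P \<noteq> {}} = (UNIV :: 'a::metric_space compacts set)"
proof (intro set_eqI iffI UNIV_I)
  fix K :: "'a compacts"
  let ?A = "Rep_compacts K"
  have A: "compact ?A" "?A \<noteq> {}" using Rep_compacts[of K] by auto
  show "K \<in> closure {Abs_compacts P | P. finite P \<and> P \<noteq> {}}"
    unfolding closure_approachable
  proof (intro allI impI)
    fix e :: real assume e: "e > 0"
    obtain P where P: "finite P" "P \<subseteq> ?A" "?A \<subseteq> (\<Union>x\<in>P. ball x (e / 2))"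
    proof (rule compactE_image[OF A(1), of ?A "\<lambda>x. ball x (e / 2)"])
      show "?A \<subseteq> (\<Union>x\<in>?A. ball x (e / 2))" using e by auto
    qed auto
    have ne: "P \<noteq> {}" using P A by auto
    have Pc: "Rep_compacts (Abs_compacts P) = P"
      using P ne by (intro Abs_compacts_inverse) (auto simp: finite_imp_compact)
    have "hausdorff_dist P ?A \<le> e / 2"
    proof (subst hausdorff_dist_le_iff)
      have "infdist x ?A = 0" if "x \<in> P" for x using P(2) that by (intro infdist_zero) blast
      moreover have "infdist x P \<le> e / 2" if "x \<in> ?A" for x
      proof -
        have "x \<in> (\<Union>x\<in>P. ball x (e / 2))" using P(3) \<open>x \<in> ?A\<close> by (rule subsetD)
        then obtain y where "y \<in> P" "dist y x < e / 2" by auto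
        then show ?thesis using infdist_le[of y P x] by (simp add: dist_commute)
      qed
      ultimately show "0 \<le> e / 2 \<and> (\<forall>x\<in>P. infdist x ?A \<le> e / 2) \<and> (\<forall>x\<in>?A. infdist x P \<le> e / 2)"
        using e by simp
    qed (use A P ne in \<open>auto simp: compact_imp_bounded finite_imp_bounded\<close>)
    then have "dist (Abs_compacts P) K < e" using e by (simp add: dist_compacts.rep_eq Pc)
    then show "\<exists>y\<in>{Abs_compacts P | P. finite P \<and> P \<noteq> {}}. dist y K < e" using P ne by blast
  qed
qed

lemma is_barcode_map_unique:
  assumes "is_barcode_map F k \<beta>" "is_barcode_map F k \<beta>'"
  shows "\<beta> = \<beta>'"
proof -
  have "closed {K. \<beta> K = \<beta>' K}"
    using assms by (intro closed_Collect_eq) (auto simp: is_barcode_map_def)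
  moreover have "{Abs_compacts P | P. finite P \<and> P \<noteq> {}} \<subseteq> {K. \<beta> K = \<beta>' K}"
    using assms unfolding is_barcode_map_def by (clarify) metis
  ultimately have "{K. \<beta> K = \<beta>' K} = UNIV"
    using closure_minimal finite_compacts_dense by blast
  then show ?thesis by auto
qed


section \<open>Type 2\<close>

definition rademacher :: "'w measure \<Rightarrow> (nat \<Rightarrow> 'w \<Rightarrow> real) \<Rightarrow> bool" where
  "rademacher M \<epsilon> \<longleftrightarrow> prob_space M \<and> prob_space.indep_vars M (\<lambda>_. borel) \<epsilon> UNIV \<and>
     (\<forall>i. \<forall>\<omega>\<in>space M. \<epsilon> i \<omega> \<in> {1, -1}) \<and>
     (\<forall>i. measure M {\<omega>\<in>space M. \<epsilon> i \<omega> = 1} = 1 / 2 \<and> measure M {\<omega>\<in>space M. \<epsilon> i \<omega> = -1} = 1 / 2)"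

text \<open>
  A definition cannot quantify over the type of the sample space, so the Rademacher sequences range
  over those on probability spaces of one type; lemma \<open>type_2_any_space\<close> shows that the property
  then holds for Rademacher sequences on all probability spaces.
\<close>

definition type_2 :: "'v::banach itself \<Rightarrow> bool" where
  "type_2 V \<longleftrightarrow> (\<forall>(M :: (nat \<Rightarrow> real) measure) \<epsilon>. rademacher M \<epsilon> \<longrightarrow>
     (\<exists>C. \<forall>n (x :: nat \<Rightarrow> 'v).
        sqrt (\<integral>\<omega>. (norm (\<Sum>i<n. \<epsilon> i \<omega> *\<^sub>R x i))\<^sup>2 \<partial>M) \<le> C * sqrt (\<Sum>i<n. (norm (x i))\<^sup>2)))"

lemma borel_measurable_sign_sum:
  fixes P :: "(nat \<Rightarrow> real) measure" and x :: "nat \<Rightarrow> 'v::banach"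
  assumes P: "P = (\<Pi>\<^sub>M i\<in>(UNIV :: nat set). restrict_space borel {1, -1 :: real})"
    and proj: "\<And>i. (\<lambda>g. g i) \<in> borel_measurable P"
  shows "(\<lambda>g. (norm (\<Sum>i<n. g i *\<^sub>R x i))\<^sup>2) \<in> borel_measurable P"
proof -
  have sub: "(\<lambda>g. g i) ` space P \<subseteq> {1, -1}" for i
    unfolding P by (auto simp: space_PiM space_restrict_space)
  have "simple_function P (\<lambda>g. g i)" for i
    by (rule simple_function_borel_measurable[OF proj]) (use finite_subset[OF sub] in simp)
  then have "simple_function P (\<lambda>g. g i *\<^sub>R x i)" for i
    using simple_function_compose1[where g = "\<lambda>r. r *\<^sub>R x i" and f = "\<lambda>g. g i" and M = P] by simp
  then have "simple_function P (\<lambda>g. \<Sum>i<n. g i *\<^sub>R x i)"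
    by (intro simple_function_sum)
  then have "simple_function P (\<lambda>g. (norm (\<Sum>i<n. g i *\<^sub>R x i))\<^sup>2)"
    by (rule simple_function_compose1[where g = "\<lambda>v. (norm v)\<^sup>2"])
  then show ?thesis
    by (rule borel_measurable_simple_function)
qed

lemma type_2_any_space:
  assumes "type_2 TYPE('v::banach)" "rademacher M \<epsilon>"
  shows "\<exists>C. \<forall>n (x :: nat \<Rightarrow> 'v).
    sqrt (\<integral>\<omega>. (norm (\<Sum>i<n. \<epsilon> i \<omega> *\<^sub>R x i))\<^sup>2 \<partial>M) \<le> C * sqrt (\<Sum>i<n. (norm (x i))\<^sup>2)"
proof -
  interpret prob_space M using assms(2) by (simp add: rademacher_def)
  let ?B = "restrict_space borel {1, -1 :: real}"
  let ?P = "\<Pi>\<^sub>M i\<in>(UNIV :: nat set). ?B"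
  let ?f = "\<lambda>\<omega> i. \<epsilon> i \<omega>"
  define N where "N = distr M ?P ?f"
  have ind: "indep_vars (\<lambda>_. borel) \<epsilon> UNIV"
    and val: "\<And>i \<omega>. \<omega> \<in> space M \<Longrightarrow> \<epsilon> i \<omega> \<in> {1, -1}"
    using assms(2) by (auto simp: rademacher_def)
  have meas [measurable]: "\<epsilon> i \<in> borel_measurable M" for i using ind by (auto simp: indep_vars_def)
  have "\<epsilon> i \<in> M \<rightarrow>\<^sub>M ?B" for i by (rule measurable_restrict_space2) (use val in auto)
  then have f: "?f \<in> M \<rightarrow>\<^sub>M ?P"
    by (intro measurable_PiM_single') (use val in \<open>auto simp: space_restrict_space\<close>)
  have proj [measurable]: "(\<lambda>g. g i) \<in> borel_measurable ?P" for i
    by (rule measurable_compose[OF measurable_component_singleton[of i UNIV "\<lambda>_. ?B"]])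
       (auto intro: measurable_restrict_space1)
  have projN: "(\<lambda>g. g i) \<in> borel_measurable N" for i using proj by (simp add: N_def)
  interpret N: prob_space N unfolding N_def by (rule prob_space_distr[OF f])
  have distr_proj: "distr N borel (\<lambda>g. g i) = distr M borel (\<epsilon> i)" for i
    unfolding N_def by (subst distr_distr[OF proj f]) (simp add: o_def)
  have tup: "(\<lambda>g. g) \<in> ?P \<rightarrow>\<^sub>M (\<Pi>\<^sub>M i\<in>(UNIV :: nat set). borel)"
    by (intro measurable_PiM_single') (auto simp: space_PiM)
  have "distr N (\<Pi>\<^sub>M i\<in>UNIV. borel) (\<lambda>g. \<lambda>i\<in>UNIV. g i) =
      distr M (\<Pi>\<^sub>M i\<in>UNIV. borel) (\<lambda>\<omega>. \<lambda>i\<in>UNIV. \<epsilon> i \<omega>)"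
    unfolding N_def restrict_UNIV using distr_distr[OF tup f] by (simp add: o_def)
  also have "\<dots> = (\<Pi>\<^sub>M i\<in>UNIV. distr M borel (\<epsilon> i))"
    using ind by (subst (asm) indep_vars_iff_distr_eq_PiM) auto
  also have "\<dots> = (\<Pi>\<^sub>M i\<in>UNIV. distr N borel (\<lambda>g. g i))" by (simp add: distr_proj)
  finally have indN: "N.indep_vars (\<lambda>_. borel) (\<lambda>i g. g i) UNIV"
    by (subst N.indep_vars_iff_distr_eq_PiM) (auto intro: projN)
  have prN: "measure N {g\<in>space N. g i = c} = measure M {\<omega>\<in>space M. \<epsilon> i \<omega> = c}" for i c
  proof -
    have "measure N {g\<in>space N. g i = c} = measure (distr N borel (\<lambda>g. g i)) {c}"
      by (subst measure_distr[OF projN]) (auto intro!: arg_cong[where f = "measure N"])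
    also have "\<dots> = measure M {\<omega>\<in>space M. \<epsilon> i \<omega> = c}"
      unfolding distr_proj
      by (subst measure_distr[OF meas]) (auto intro!: arg_cong[where f = "measure M"])
    finally show ?thesis .
  qed
  have "rademacher N (\<lambda>i g. g i)"
    unfolding rademacher_def prN
    using N.prob_space_axioms indN assms(2)
    by (auto simp: rademacher_def N_def space_PiM space_restrict_space PiE_def Pi_def)
  then obtain C where C: "\<And>n (x :: nat \<Rightarrow> 'v).
      sqrt (\<integral>g. (norm (\<Sum>i<n. g i *\<^sub>R x i))\<^sup>2 \<partial>N) \<le> C * sqrt (\<Sum>i<n. (norm (x i))\<^sup>2)"
    using assms(1) unfolding type_2_def by blast
  have "(\<integral>g. (norm (\<Sum>i<n. g i *\<^sub>R x i))\<^sup>2 \<partial>N) = (\<integral>\<omega>. (norm (\<Sum>i<n. \<epsilon> i \<omega> *\<^sub>R x i))\<^sup>2 \<partial>M)"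
    for n and x :: "nat \<Rightarrow> 'v"
    unfolding N_def by (rule integral_distr[OF f borel_measurable_sign_sum[OF refl proj]])
  with C have "sqrt (\<integral>\<omega>. (norm (\<Sum>i<n. \<epsilon> i \<omega> *\<^sub>R x i))\<^sup>2 \<partial>M) \<le> C * sqrt (\<Sum>i<n. (norm (x i))\<^sup>2)"
    for n and x :: "nat \<Rightarrow> 'v" by (metis (no_types))
  then show ?thesis by blast
qed

end

theory Submission
  imports Defs
begin

text \<open>
  The barcode map is continuous, so \<open>K \<mapsto> \<parallel>T (\<beta> K)\<parallel>\<close> is a continuous real function of the compact set
  \<open>K\<close>, and continuous functions are bounded on compact sets. As the random compact set \<open>X\<close> takes its
  values in the compact family \<open>\<K>\<close>, each power of \<open>\<parallel>T (\<beta> X)\<parallel>\<close> is a bounded random variable, and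
  bounded random variables are integrable on a probability space.
\<close>

lemma (in finite_measure) integrable_continuous_compose_compact:
  fixes f :: "'b::topological_space \<Rightarrow> 'c::{banach, second_countable_topology}"
  assumes X: "X \<in> borel_measurable M" "\<And>\<omega>. \<omega> \<in> space M \<Longrightarrow> X \<omega> \<in> S"
    and S: "compact S" and f: "continuous_on UNIV f"
  shows "integrable M (\<lambda>\<omega>. f (X \<omega>))"
proof -
  have "bounded (f ` S)"
    using S f by (intro compact_imp_bounded compact_continuous_image continuous_on_subset[OF f]) auto
  then obtain B where B: "\<And>x. x \<in> S \<Longrightarrow> norm (f x) \<le> B"
    unfolding bounded_iff by auto
  show ?thesis
  proof (rule integrable_const_bound)
    show "AE \<omega> in M. norm (f (X \<omega>)) \<le> B"
      using B X(2) by auto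
    show "(\<lambda>\<omega>. f (X \<omega>)) \<in> borel_measurable M"
      by (rule measurable_compose[OF X(1) borel_measurable_continuous_onI[OF f]])
  qed
qed

theorem theorem4p3:
  fixes \<Omega> :: "'w measure"
    and X :: "'w \<Rightarrow> 'a::metric_space compacts"
    and \<K> :: "'a compacts set"
    and k :: nat
    and \<beta> :: "'a compacts \<Rightarrow> barcode cauchy_completion"
    and T :: "barcode cauchy_completion \<Rightarrow> 'v::banach"
  assumes "prob_space \<Omega>"
    and "X \<in> borel_measurable \<Omega>"
    and "compact \<K>"
    and "\<forall>\<omega>\<in>space \<Omega>. X \<omega> \<in> \<K>"
    and "is_barcode_map TYPE('k::field) k \<beta>"
    and "continuous_on UNIV T"
    and "separable_space (euclidean :: 'v topology)"
    and "type_2 TYPE('v)"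
  shows "\<forall>n::nat. integrable \<Omega> (\<lambda>\<omega>. norm (T (\<beta> (X \<omega>))) ^ n)"
proof
  fix n :: nat
  interpret prob_space \<Omega> by fact
  have "continuous_on UNIV \<beta>"
    using assms(5) by (simp add: is_barcode_map_def)
  then have "continuous_on UNIV (\<lambda>K. norm (T (\<beta> K)) ^ n)"
    by (intro continuous_intros continuous_on_compose2[OF assms(6)]) auto
  with assms(2-4) show "integrable \<Omega> (\<lambda>\<omega>. norm (T (\<beta> (X \<omega>))) ^ n)"
    by (intro integrable_continuous_compose_compact) auto
qed

end
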